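(* Let $0 < e_1 < e_2 < 1$. If a uninorm $U_1\equiv\langle T_1,e_1,S_1\rangle$ is distributive over a uninorm $U_2\equiv\langle T_2,e_2,S_2\rangle$, then $U_2 \equiv\langle T_2, e_2, \max\rangle$ (that is, $S_2=\max$) and $U_2$ is locally internal on $A(e_2)$.
   Context: A uninorm is a binary operation $U:[0,1]^2\to[0,1]$ that is commutative, associative, increasing (non-decreasing) in each variable with respect to the usual order, and has a neutral element $e\in[0,1]$. A uninorm is a t-norm if $e=1$ and a t-conorm if $e=0$. For $e\in\,]0,1[$, the notation $U\equiv\langle T,e,S\rangle$ means that $U$ is a uninorm with neutral element $e$, underlying t-norm $T$ and underlying t-conorm $S$, i.e. $T,S:[0,1]^2\to[0,1]$ are the t-norm and t-conorm with $U(x,y)=e\,T\left(\frac{x}{e},\frac{y}{e}\right)$ for $x,y\in[0,e]$ and $U(x,y)=e+(1-e)\,S\left(\frac{x-e}{1-e},\frac{y-e}{1-e}\right)$ for $x,y\in[e,1]$. $A(e)=[0,1]^2\setminus([0,e]^2\cup[e,1]^2)$. A uninorm $U$ with neutral element $e$ is locally internal on $A(e)$ if $U(x,y)\in\{x,y\}$ for all $(x,y)\in A(e)$. A uninorm $U_1$ is distributive over a uninorm $U_2$ if $U_1(x,U_2(y,z))=U_2(U_1(x,y),U_1(x,z))$ for all $x,y,z\in[0,1]$. *)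

theory Defs
  imports Complex_Main
begin

text \<open>
  Operations on the unit interval are total functions on the reals; only their values on
  \<open>{0..1}\<close> are constrained, and equality of operations means agreement on \<open>{0..1}\<close>.
\<close>

definition uninorm_with :: "real \<Rightarrow> (real \<Rightarrow> real \<Rightarrow> real) \<Rightarrow> bool" where
  "uninorm_with e U \<longleftrightarrow>
     e \<in> {0..1} \<and>
     (\<forall>x\<in>{0..1}. \<forall>y\<in>{0..1}. U x y \<in> {0..1}) \<and>
     (\<forall>x\<in>{0..1}. \<forall>y\<in>{0..1}. U x y = U y x) \<and>
     (\<forall>x\<in>{0..1}. \<forall>y\<in>{0..1}. \<forall>z\<in>{0..1}. U (U x y) z = U x (U y z)) \<and>
     (\<forall>y\<in>{0..1}. mono_on {0..1} (\<lambda>x. U x y)) \<and>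
     (\<forall>x\<in>{0..1}. mono_on {0..1} (\<lambda>y. U x y)) \<and>
     (\<forall>x\<in>{0..1}. U e x = x \<and> U x e = x)"

definition t_norm :: "(real \<Rightarrow> real \<Rightarrow> real) \<Rightarrow> bool" where
  "t_norm T \<longleftrightarrow> uninorm_with 1 T"

definition t_conorm :: "(real \<Rightarrow> real \<Rightarrow> real) \<Rightarrow> bool" where
  "t_conorm S \<longleftrightarrow> uninorm_with 0 S"

definition uninorm_decomp ::
  "(real \<Rightarrow> real \<Rightarrow> real) \<Rightarrow> (real \<Rightarrow> real \<Rightarrow> real) \<Rightarrow> real \<Rightarrow> (real \<Rightarrow> real \<Rightarrow> real) \<Rightarrow> bool"
  ("(_ \<equiv>\<^sub>U \<langle>_,/ _,/ _\<rangle>)" [51, 0, 0, 0] 50) where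
  "U \<equiv>\<^sub>U \<langle>T, e, S\<rangle> \<longleftrightarrow>
     0 < e \<and> e < 1 \<and> uninorm_with e U \<and> t_norm T \<and> t_conorm S \<and>
     (\<forall>x\<in>{0..e}. \<forall>y\<in>{0..e}. U x y = e * T (x / e) (y / e)) \<and>
     (\<forall>x\<in>{e..1}. \<forall>y\<in>{e..1}.
        U x y = e + (1 - e) * S ((x - e) / (1 - e)) ((y - e) / (1 - e)))"

definition A_region :: "real \<Rightarrow> (real \<times> real) set" where
  "A_region e = ({0..1} \<times> {0..1}) - (({0..e} \<times> {0..e}) \<union> ({e..1} \<times> {e..1}))"

definition locally_internal_on :: "(real \<Rightarrow> real \<Rightarrow> real) \<Rightarrow> (real \<times> real) set \<Rightarrow> bool" where
  "locally_internal_on U D \<longleftrightarrow> (\<forall>(x, y)\<in>D. U x y \<in> {x, y})"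

definition distributive_over ::
  "(real \<Rightarrow> real \<Rightarrow> real) \<Rightarrow> (real \<Rightarrow> real \<Rightarrow> real) \<Rightarrow> bool" where
  "distributive_over U V \<longleftrightarrow>
     (\<forall>x\<in>{0..1}. \<forall>y\<in>{0..1}. \<forall>z\<in>{0..1}. U x (V y z) = V (U x y) (U x z))"

end

theory Submission
  imports Defs
begin

text \<open>
  Write \<open>*\<close> for \<open>U1\<close> and \<open>+\<close> for \<open>U2\<close>. Since \<open>e1 + e2 = e1\<close>, distributing
  \<open>x = x * (e1 + e2)\<close> gives the absorption law \<open>x = x + x * e2\<close> for every \<open>x\<close>
  (\<open>absorbs_mult_neutral\<close>). On the other hand \<open>x \<le> x * e2\<close>, because \<open>e1 \<le> e2\<close>.

  On \<open>[e2, 1]\<close>, where adding only increases, absorption squeezes \<open>x + x\<close> between \<open>x\<close> and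
  \<open>x + x * e2 = x\<close>, so every element is idempotent and \<open>+\<close> must be the maximum there. In the
  same way it shows that \<open>y * e2 = y\<close> for \<open>y \<ge> e2\<close>.

  For \<open>x \<le> e2 \<le> y\<close> put \<open>w = x + y\<close>, so that \<open>x \<le> w \<le> y\<close> and \<open>w + y = w\<close>. If
  \<open>w \<ge> e2\<close>, the latter forces \<open>w = y\<close>. If \<open>w \<le> e2\<close>, then
  \<open>w * e2 = x * e2 + y * e2 = x * e2 + y\<close>; adding \<open>x\<close> and absorbing \<open>x * e2\<close> leaves
  \<open>x + w * e2 = w\<close>, and since \<open>w * e2 \<le> e2\<close> the left-hand side is at most \<open>x\<close>.
\<close>

section \<open>Uninorms\<close>

context
  fixes e :: real and U :: "real \<Rightarrow> real \<Rightarrow> real"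
  assumes U: "uninorm_with e U"
begin

lemma uninorm_closed: "x \<in> {0..1} \<Longrightarrow> y \<in> {0..1} \<Longrightarrow> U x y \<in> {0..1}"
  using U unfolding uninorm_with_def by blast

lemma uninorm_commute: "x \<in> {0..1} \<Longrightarrow> y \<in> {0..1} \<Longrightarrow> U x y = U y x"
  using U unfolding uninorm_with_def by blast

lemma uninorm_assoc:
  "x \<in> {0..1} \<Longrightarrow> y \<in> {0..1} \<Longrightarrow> z \<in> {0..1} \<Longrightarrow> U (U x y) z = U x (U y z)"
  using U unfolding uninorm_with_def by blast

lemma uninorm_mono:
  assumes "x \<in> {0..1}" "x' \<in> {0..1}" "y \<in> {0..1}" "y' \<in> {0..1}" "x \<le> x'" "y \<le> y'"
  shows "U x y \<le> U x' y'"
proof -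
  have "U x y \<le> U x' y"
    using U assms unfolding uninorm_with_def mono_on_def by blast
  also have "\<dots> \<le> U x' y'"
    using U assms unfolding uninorm_with_def mono_on_def by blast
  finally show ?thesis .
qed

lemma uninorm_neutral_in: "e \<in> {0..1}"
  using U unfolding uninorm_with_def by blast

lemma uninorm_neutral_left: "x \<in> {0..1} \<Longrightarrow> U e x = x"
  using U unfolding uninorm_with_def by blast

lemma uninorm_neutral_right: "x \<in> {0..1} \<Longrightarrow> U x e = x"
  using U unfolding uninorm_with_def by blast

lemma uninorm_ge_left:
  assumes "x \<in> {0..1}" "y \<in> {0..1}" "e \<le> y"
  shows "x \<le> U x y"
  using uninorm_mono[of x x e y] uninorm_neutral_in uninorm_neutral_right assms by simp

lemma uninorm_ge_right:
  assumes "x \<in> {0..1}" "y \<in> {0..1}" "e \<le> x"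
  shows "y \<le> U x y"
  using uninorm_mono[of e x y y] uninorm_neutral_in uninorm_neutral_left assms by simp

lemma uninorm_le_left:
  assumes "x \<in> {0..1}" "y \<in> {0..1}" "y \<le> e"
  shows "U x y \<le> x"
  using uninorm_mono[of x x y e] uninorm_neutral_in uninorm_neutral_right assms by simp

lemma uninorm_le_right:
  assumes "x \<in> {0..1}" "y \<in> {0..1}" "x \<le> e"
  shows "U x y \<le> y"
  using uninorm_mono[of x e y y] uninorm_neutral_in uninorm_neutral_left assms by simp

text \<open>
  A value of \<open>U\<close> at two points above the neutral element lies above both of them, and
  idempotency of the larger one bounds it from the other side.
\<close>

lemma idempotent_above_neutral_imp_max:
  assumes idem: "\<And>z. z \<in> {e..1} \<Longrightarrow> U z z = z"
    and x: "x \<in> {e..1}" and y: "y \<in> {e..1}"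
  shows "U x y = max x y"
proof -
  have in01: "x \<in> {0..1}" "y \<in> {0..1}" "max x y \<in> {0..1}"
    using x y uninorm_neutral_in by auto
  have "U x y \<le> U (max x y) (max x y)"
    using in01 by (intro uninorm_mono) auto
  also have "\<dots> = max x y"
    using idem[of "max x y"] x y by auto
  finally show ?thesis
    using uninorm_ge_left[of x y] uninorm_ge_right[of x y] in01 x y by auto
qed

end

lemma t_conorm_max: "t_conorm max"
  unfolding t_conorm_def uninorm_with_def by (auto simp: mono_on_def max_def)

text \<open>The affine bijection from \<open>[0, 1]\<close> to \<open>[e, 1]\<close> commutes with the maximum.\<close>

lemma decomp_conorm_eq_max:
  assumes dec: "U \<equiv>\<^sub>U \<langle>T, e, S\<rangle>"
    and max: "\<And>x y. x \<in> {e..1} \<Longrightarrow> y \<in> {e..1} \<Longrightarrow> U x y = max x y"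
    and x: "x \<in> {0..1}" and y: "y \<in> {0..1}"
  shows "S x y = max x y"
proof -
  define g where "g t = e + (1 - e) * t" for t
  have e: "0 < e" "e < 1"
    using dec by (auto simp: uninorm_decomp_def)
  have g_in: "g t \<in> {e..1}" if "t \<in> {0..1}" for t
  proof -
    have "0 \<le> (1 - e) * t" "(1 - e) * t \<le> 1 - e"
      using that e by (simp_all add: mult_left_le)
    thus ?thesis
      by (simp add: g_def)
  qed
  have g_inv: "(g t - e) / (1 - e) = t" for t
    using e by (simp add: g_def)
  have g_max: "max (g x) (g y) = g (max x y)"
    using e by (auto simp: g_def max_def)
  have "U (g x) (g y) = g (S x y)"
    using dec g_in[OF x] g_in[OF y]
    unfolding uninorm_decomp_def by (simp add: g_inv g_def[of "S x y"])
  hence "g (S x y) = g (max x y)"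
    using max[OF g_in[OF x] g_in[OF y]] g_max by simp
  thus ?thesis
    using e by (simp add: g_def)
qed

lemma decomp_replace_conorm:
  assumes dec: "U \<equiv>\<^sub>U \<langle>T, e, S\<rangle>" and S': "t_conorm S'"
    and eq: "\<And>x y. x \<in> {0..1} \<Longrightarrow> y \<in> {0..1} \<Longrightarrow> S x y = S' x y"
  shows "U \<equiv>\<^sub>U \<langle>T, e, S'\<rangle>"
proof -
  have "e < 1"
    using dec by (simp add: uninorm_decomp_def)
  hence "(t - e) / (1 - e) \<in> {0..1}" if "t \<in> {e..1}" for t
    using that by (simp add: divide_simps)
  thus ?thesis
    using dec S' eq unfolding uninorm_decomp_def by simp
qed

section \<open>Distributivity\<close>

context
  fixes e1 e2 :: real and U1 U2 :: "real \<Rightarrow> real \<Rightarrow> real"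
  assumes U1: "uninorm_with e1 U1" and U2: "uninorm_with e2 U2"
    and distr: "distributive_over U1 U2"
begin

lemma absorbs_mult_neutral:
  assumes x: "x \<in> {0..1}"
  shows "U2 x (U1 x e2) = x"
proof -
  note e1 = uninorm_neutral_in[OF U1] and e2 = uninorm_neutral_in[OF U2]
  have "U2 x (U1 x e2) = U2 (U1 x e1) (U1 x e2)"
    by (simp add: uninorm_neutral_right[OF U1 x])
  also have "\<dots> = U1 x (U2 e1 e2)"
    using distr x e1 e2 unfolding distributive_over_def by simp
  also have "\<dots> = x"
    by (simp add: uninorm_neutral_right[OF U2 e1] uninorm_neutral_right[OF U1 x])
  finally show ?thesis .
qed

context
  assumes e1_le_e2: "e1 \<le> e2"
begin

lemma idempotent_above_neutral:
  assumes x: "x \<in> {e2..1}"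
  shows "U2 x x = x"
proof (rule antisym)
  have x01: "x \<in> {0..1}"
    using x uninorm_neutral_in[OF U2] by auto
  note e2 = uninorm_neutral_in[OF U2]
  have "x \<le> U1 x e2"
    by (rule uninorm_ge_left[OF U1 x01 e2 e1_le_e2])
  hence "U2 x x \<le> U2 x (U1 x e2)"
    by (intro uninorm_mono[OF U2] x01 uninorm_closed[OF U1] e2 order_refl)
  thus "U2 x x \<le> x"
    by (simp add: absorbs_mult_neutral[OF x01])
  show "x \<le> U2 x x"
    using uninorm_ge_left[OF U2 x01 x01] x by simp
qed

lemma mult_neutral_above:
  assumes y: "y \<in> {e2..1}"
  shows "U1 y e2 = y"
proof (rule antisym)
  have y01: "y \<in> {0..1}"
    using y uninorm_neutral_in[OF U2] by auto
  note e2 = uninorm_neutral_in[OF U2]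
  show "y \<le> U1 y e2"
    by (rule uninorm_ge_left[OF U1 y01 e2 e1_le_e2])
  have "U1 y e2 \<le> U2 y (U1 y e2)"
    using uninorm_ge_right[OF U2 y01 uninorm_closed[OF U1 y01 e2]] y by simp
  thus "U1 y e2 \<le> y"
    by (simp add: absorbs_mult_neutral[OF y01])
qed

text \<open>
  When the sum \<open>w = x + y\<close> falls below \<open>e2\<close>, multiplying it by \<open>e2\<close> keeps it below
  \<open>e2\<close>, fixes the summand \<open>y\<close> and turns \<open>x\<close> into an element that \<open>x\<close> absorbs. Hence
  adding \<open>x\<close> to \<open>w * e2\<close> returns \<open>w\<close> but cannot exceed \<open>x\<close>.
\<close>

lemma internal_across_neutral:
  assumes x: "x \<in> {0..e2}" and y: "y \<in> {e2..1}"
  shows "U2 x y \<in> {x, y}"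
proof -
  define w where "w = U2 x y"
  note e2 = uninorm_neutral_in[OF U2]
  have in01: "x \<in> {0..1}" "y \<in> {0..1}"
    using x y e2 by auto
  have w01: "w \<in> {0..1}"
    unfolding w_def by (intro uninorm_closed[OF U2] in01)
  have bounds: "x \<le> w" "w \<le> y"
    using uninorm_ge_left[OF U2 in01] uninorm_le_right[OF U2 in01] x y
    by (simp_all add: w_def)
  show ?thesis
  proof (cases "e2 \<le> w")
    case True
    have "y \<le> U2 w y"
      by (rule uninorm_ge_right[OF U2 w01 in01(2) True])
    also have "\<dots> = w"
      unfolding w_def
      by (simp add: uninorm_assoc[OF U2 in01 in01(2)] idempotent_above_neutral[OF y])
    finally show ?thesis
      using bounds by (simp add: w_def)
  next
    case False
    have cl: "U1 x e2 \<in> {0..1}" "U1 w e2 \<in> {0..1}"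
      by (intro uninorm_closed[OF U1] in01 w01 e2)+
    have "U1 w e2 = U1 e2 (U2 x y)"
      unfolding w_def[symmetric] by (rule uninorm_commute[OF U1 w01 e2])
    also have "\<dots> = U2 (U1 e2 x) (U1 e2 y)"
      using distr in01 e2 unfolding distributive_over_def by blast
    also have "\<dots> = U2 (U1 x e2) y"
      by (simp add: uninorm_commute[OF U1 e2 in01(1)] uninorm_commute[OF U1 e2 in01(2)]
          mult_neutral_above[OF y])
    finally have "U2 x (U1 w e2) = U2 x (U2 (U1 x e2) y)"
      by simp
    also have "\<dots> = w"
      using uninorm_assoc[OF U2 in01(1) cl(1) in01(2)] absorbs_mult_neutral[OF in01(1)]
      by (simp add: w_def)
    finally have w_eq: "U2 x (U1 w e2) = w" .
    have "U1 w e2 \<le> U1 e2 e2"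
      using False by (intro uninorm_mono[OF U1] w01 e2) simp_all
    also have "\<dots> = e2"
      using e2 by (intro mult_neutral_above) simp
    finally have "U2 x (U1 w e2) \<le> x"
      by (rule uninorm_le_left[OF U2 in01(1) cl(2)])
    thus ?thesis
      using bounds w_eq by (simp add: w_def)
  qed
qed

lemma locally_internal_of_distributive: "locally_internal_on U2 (A_region e2)"
proof -
  have "U2 x y \<in> {x, y}" if xy: "(x, y) \<in> A_region e2" for x y
  proof -
    have in01: "x \<in> {0..1}" "y \<in> {0..1}"
      using xy by (auto simp: A_region_def)
    consider "x \<in> {0..e2}" "y \<in> {e2..1}" | "y \<in> {0..e2}" "x \<in> {e2..1}"
      using xy by (fastforce simp: A_region_def)
    thus ?thesis
    proof cases
      case 1
      thus ?thesis by (rule internal_across_neutral)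
    next
      case 2
      hence "U2 y x \<in> {y, x}" by (rule internal_across_neutral)
      thus ?thesis using uninorm_commute[OF U2 in01] by auto
    qed
  qed
  thus ?thesis
    unfolding locally_internal_on_def by blast
qed

end

end

theorem corollary2:
  fixes e1 e2 :: real
    and U1 U2 T1 T2 S1 S2 :: "real \<Rightarrow> real \<Rightarrow> real"
  assumes "0 < e1" and "e1 < e2" and "e2 < 1"
    and "U1 \<equiv>\<^sub>U \<langle>T1, e1, S1\<rangle>"
    and "U2 \<equiv>\<^sub>U \<langle>T2, e2, S2\<rangle>"
    and "distributive_over U1 U2"
  shows "(U2 \<equiv>\<^sub>U \<langle>T2, e2, max\<rangle>)
    \<and> (\<forall>x\<in>{0..1}. \<forall>y\<in>{0..1}. S2 x y = max x y)
    \<and> locally_internal_on U2 (A_region e2)"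
proof -
  have U1: "uninorm_with e1 U1" and U2: "uninorm_with e2 U2"
    using assms(4,5) by (simp_all add: uninorm_decomp_def)
  have le: "e1 \<le> e2"
    using assms(2) by simp
  note idem = idempotent_above_neutral[OF U1 U2 assms(6) le]
  have S2: "S2 x y = max x y" if "x \<in> {0..1}" "y \<in> {0..1}" for x y
    using decomp_conorm_eq_max[OF assms(5) idempotent_above_neutral_imp_max[OF U2 idem]] that
    by blast
  show ?thesis
    using decomp_replace_conorm[OF assms(5) t_conorm_max S2] S2
      locally_internal_of_distributive[OF U1 U2 assms(6) le]
    by blast
qed

end
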